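(* Let $(M^{2m+1},A,Q,\eta,\xi,g)$ be a weak almost contact metric manifold, considered as a generalized Riemannian manifold $(M,G=g+F)$ with $F(X,Y)=g(AX,Y)$. Suppose that $\nabla$ is a generalized metric connection (i.e. a linear connection with $\nabla G=0$) whose torsion $(0,3)$-tensor $T$ is totally skew-symmetric. Then: i) The Reeb vector field $\xi$ is a geodesic and Killing vector field (i.e. $\nabla^g_\xi\xi=0$ and $g(\nabla^g_X\xi,Y)+g(\nabla^g_Y\xi,X)=0$ for all $X,Y$). ii) The connection $\nabla$ satisfies the $Q$-torsion condition $$T(QX,Y)=T(X,QY)=Q\,T(X,Y)\quad\text{for all vector fields }X,Y$$ if and only if the $(0,3)$-tensor $$N_A^{\mathrm{wac}}:=N_A+d\eta\otimes\eta$$ (the Nijenhuis tensor in weak almost contact geometry) is totally skew-symmetric.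
   Context: A weak almost contact metric manifold $(M,A,Q,\eta,\xi,g)$ is a $(2m+1)$-dimensional Riemannian manifold $(M,g)$ with a $(1,1)$-tensor $A$ of rank $2m$, skew-symmetric with respect to $g$, a non-singular $(1,1)$-tensor $Q\ne\mathrm{Id}$, a vector field $\xi$ and a 1-form $\eta$ dual to $\xi$, $\eta(X)=g(X,\xi)$, $\eta(\xi)=1$, satisfying $A^2=-Q+\eta\otimes\xi$, $g(AX,AY)=g(QX,Y)-\eta(X)\eta(Y)$, $A\xi=0$, $Q\xi=\xi$. Then $F(X,Y)=g(AX,Y)$ is a 2-form of rank $2m$; $G=g+F$ has symmetric part $g$ and skew-symmetric part $F$. $\nabla^g$ denotes the Levi-Civita connection of $g$. The torsion of $\nabla$ is $T(X,Y)=\nabla_XY-\nabla_YX-[X,Y]$, and $T(X,Y,Z):=g(T(X,Y),Z)$. The condition $\nabla G=0$ is equivalent to $\nabla g=\nabla F=0$. The Nijenhuis tensor of $A$ is $N_A(X,Y)=[AX,AY]+A^2[X,Y]-A[AX,Y]-A[X,AY]$, with $N_A(X,Y,Z):=g(N_A(X,Y),Z)$. The exterior derivative of $\eta$ is normalized by $d\eta(X,Y)=(\nabla^g_X\eta)(Y)-(\nabla^g_Y\eta)(X)$, and $(d\eta\otimes\eta)(X,Y,Z)=d\eta(X,Y)\,\eta(Z)$. *)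

theory Defs
  imports "HOL-Analysis.Analysis" "HOL-Library.Function_Algebras"
begin

text \<open>
  Sums, differences, products and zero of functions are the pointwise ones of
  Function_Algebras. The instance below adds scalar multiplication, so that the library
  notions for real vector spaces (in particular dim) apply to spaces of functionals.
\<close>

instantiation "fun" :: (type, real_vector) real_vector
begin

definition scaleR_fun :: "real \<Rightarrow> ('a \<Rightarrow> 'b) \<Rightarrow> 'a \<Rightarrow> 'b" where
  "scaleR_fun c f = (\<lambda>x. c *\<^sub>R f x)"

instance
  by standard (simp_all add: scaleR_fun_def fun_eq_iff plus_fun_def algebra_simps)

end


section \<open>Smooth manifolds\<close>

text \<open>
  Functions of class C^k, for use on open sets S: all directional derivatives are of
  class C^(k-1).
\<close>

primrec Ck_on :: "nat \<Rightarrow> 'e::real_normed_vector set \<Rightarrow> ('e \<Rightarrow> 'b::real_normed_vector) \<Rightarrow> bool" where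
  "Ck_on 0 S f \<longleftrightarrow> continuous_on S f"
| "Ck_on (Suc k) S f \<longleftrightarrow>
     (\<exists>D. (\<forall>x\<in>S. (f has_derivative D x) (at x)) \<and> (\<forall>v. Ck_on k S (\<lambda>x. D x v)))"

definition smooth_on :: "'e::real_normed_vector set \<Rightarrow> ('e \<Rightarrow> 'b::real_normed_vector) \<Rightarrow> bool" where
  "smooth_on S f \<longleftrightarrow> (\<forall>k. Ck_on k S f)"

text \<open>
  A chart is a pair of its domain and its coordinate map; the values of the coordinate
  map outside the domain are irrelevant. The underlying space of the manifold is the whole type
  'a, and M is a smooth atlas on it, not necessarily maximal. The model space is the
  Euclidean space 'e, so the dimension is DIM('e).
\<close>

type_synonym ('a, 'e) chart = "'a set \<times> ('a \<Rightarrow> 'e)"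

definition is_chart :: "('a::topological_space, 'e::euclidean_space) chart \<Rightarrow> bool" where
  "is_chart c \<longleftrightarrow> (case c of (U, \<phi>) \<Rightarrow>
     open U \<and> open (\<phi> ` U) \<and> (\<exists>\<psi>. homeomorphism U (\<phi> ` U) \<phi> \<psi>))"

definition smooth_manifold ::
  "('a::{t2_space, second_countable_topology}, 'e::euclidean_space) chart set \<Rightarrow> bool" where
  "smooth_manifold M \<longleftrightarrow>
     (\<forall>c\<in>M. is_chart c) \<and>
     (\<Union>(U, \<phi>)\<in>M. U) = UNIV \<and>
     (\<forall>(U, \<phi>)\<in>M. \<forall>(V, \<psi>)\<in>M. smooth_on (\<phi> ` (U \<inter> V)) (\<psi> \<circ> inv_into U \<phi>))"

definition smooth :: "('a, 'e::euclidean_space) chart set \<Rightarrow> ('a \<Rightarrow> real) \<Rightarrow> bool" where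
  "smooth M f \<longleftrightarrow> (\<forall>(U, \<phi>)\<in>M. smooth_on (\<phi> ` U) (f \<circ> inv_into U \<phi>))"


section \<open>Vector fields and tensor fields\<close>

text \<open>
  Tangent vectors at p are the derivations at p of the algebra of smooth functions. They are
  extended by zero to non-smooth functions, so that equality of tangent vectors is
  equality in HOL.
\<close>

type_synonym 'a tvec = "('a \<Rightarrow> real) \<Rightarrow> real"
type_synonym 'a vfield = "'a \<Rightarrow> 'a tvec"

definition tangent_space :: "('a, 'e::euclidean_space) chart set \<Rightarrow> 'a \<Rightarrow> 'a tvec set" where
  "tangent_space M p = {v.
     (\<forall>f h. smooth M f \<longrightarrow> smooth M h \<longrightarrow> v (f + h) = v f + v h) \<and>
     (\<forall>c f. smooth M f \<longrightarrow> v (c *\<^sub>R f) = c * v f) \<and>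
     (\<forall>f h. smooth M f \<longrightarrow> smooth M h \<longrightarrow> v (f * h) = v f * h p + f p * v h) \<and>
     (\<forall>f. \<not> smooth M f \<longrightarrow> v f = 0)}"

text \<open>The derivative of the function f along the vector field X.\<close>

definition ddir :: "'a vfield \<Rightarrow> ('a \<Rightarrow> real) \<Rightarrow> 'a \<Rightarrow> real" where
  "ddir X f = (\<lambda>p. X p f)"

text \<open>Smooth vector fields.\<close>

definition vector_field :: "('a, 'e::euclidean_space) chart set \<Rightarrow> 'a vfield \<Rightarrow> bool" where
  "vector_field M X \<longleftrightarrow>
     (\<forall>p. X p \<in> tangent_space M p) \<and> (\<forall>f. smooth M f \<longrightarrow> smooth M (ddir X f))"

definition fmult :: "('a \<Rightarrow> real) \<Rightarrow> 'a vfield \<Rightarrow> 'a vfield" where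
  "fmult f X = (\<lambda>p. f p *\<^sub>R X p)"

definition lie_bracket :: "'a vfield \<Rightarrow> 'a vfield \<Rightarrow> 'a vfield" where
  "lie_bracket X Y = (\<lambda>p f. X p (ddir Y f) - Y p (ddir X f))"

text \<open>
  Tensor fields are families of (multi)linear maps on the tangent spaces; their values on
  functionals that are not tangent vectors are irrelevant. Smoothness is tested on
  smooth vector fields.
\<close>

type_synonym 'a tensor11 = "'a \<Rightarrow> 'a tvec \<Rightarrow> 'a tvec"
type_synonym 'a tensor01 = "'a \<Rightarrow> 'a tvec \<Rightarrow> real"
type_synonym 'a tensor02 = "'a \<Rightarrow> 'a tvec \<Rightarrow> 'a tvec \<Rightarrow> real"

definition app11 :: "'a tensor11 \<Rightarrow> 'a vfield \<Rightarrow> 'a vfield" where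
  "app11 A X = (\<lambda>p. A p (X p))"

definition app01 :: "'a tensor01 \<Rightarrow> 'a vfield \<Rightarrow> 'a \<Rightarrow> real" where
  "app01 \<eta> X = (\<lambda>p. \<eta> p (X p))"

definition app02 :: "'a tensor02 \<Rightarrow> 'a vfield \<Rightarrow> 'a vfield \<Rightarrow> 'a \<Rightarrow> real" where
  "app02 G X Y = (\<lambda>p. G p (X p) (Y p))"

definition tensor11 :: "('a, 'e::euclidean_space) chart set \<Rightarrow> 'a tensor11 \<Rightarrow> bool" where
  "tensor11 M A \<longleftrightarrow>
     (\<forall>p. \<forall>v\<in>tangent_space M p. A p v \<in> tangent_space M p) \<and>
     (\<forall>p. \<forall>v\<in>tangent_space M p. \<forall>w\<in>tangent_space M p. A p (v + w) = A p v + A p w) \<and>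
     (\<forall>p. \<forall>v\<in>tangent_space M p. \<forall>c. A p (c *\<^sub>R v) = c *\<^sub>R A p v) \<and>
     (\<forall>X. vector_field M X \<longrightarrow> vector_field M (app11 A X))"

definition one_form :: "('a, 'e::euclidean_space) chart set \<Rightarrow> 'a tensor01 \<Rightarrow> bool" where
  "one_form M \<eta> \<longleftrightarrow>
     (\<forall>p. \<forall>v\<in>tangent_space M p. \<forall>w\<in>tangent_space M p. \<eta> p (v + w) = \<eta> p v + \<eta> p w) \<and>
     (\<forall>p. \<forall>v\<in>tangent_space M p. \<forall>c. \<eta> p (c *\<^sub>R v) = c * \<eta> p v) \<and>
     (\<forall>X. vector_field M X \<longrightarrow> smooth M (app01 \<eta> X))"

definition tensor02 :: "('a, 'e::euclidean_space) chart set \<Rightarrow> 'a tensor02 \<Rightarrow> bool" where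
  "tensor02 M G \<longleftrightarrow>
     (\<forall>p. \<forall>u\<in>tangent_space M p. \<forall>v\<in>tangent_space M p. \<forall>w\<in>tangent_space M p.
        G p (u + v) w = G p u w + G p v w \<and> G p w (u + v) = G p w u + G p w v) \<and>
     (\<forall>p. \<forall>v\<in>tangent_space M p. \<forall>w\<in>tangent_space M p. \<forall>c.
        G p (c *\<^sub>R v) w = c * G p v w \<and> G p v (c *\<^sub>R w) = c * G p v w) \<and>
     (\<forall>X Y. vector_field M X \<longrightarrow> vector_field M Y \<longrightarrow> smooth M (app02 G X Y))"

definition riemannian_metric :: "('a, 'e::euclidean_space) chart set \<Rightarrow> 'a tensor02 \<Rightarrow> bool" where
  "riemannian_metric M g \<longleftrightarrow>
     tensor02 M g \<and>
     (\<forall>p. \<forall>v\<in>tangent_space M p. \<forall>w\<in>tangent_space M p. g p v w = g p w v) \<and>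
     (\<forall>p. \<forall>v\<in>tangent_space M p. v \<noteq> 0 \<longrightarrow> g p v v > 0)"


section \<open>Linear connections\<close>

text \<open>\<open>D X Y\<close> is the covariant derivative of Y along X.\<close>

type_synonym 'a connection = "'a vfield \<Rightarrow> 'a vfield \<Rightarrow> 'a vfield"

definition linear_connection :: "('a, 'e::euclidean_space) chart set \<Rightarrow> 'a connection \<Rightarrow> bool" where
  "linear_connection M D \<longleftrightarrow>
     (\<forall>X Y. vector_field M X \<longrightarrow> vector_field M Y \<longrightarrow> vector_field M (D X Y)) \<and>
     (\<forall>X Y Z. vector_field M X \<longrightarrow> vector_field M Y \<longrightarrow> vector_field M Z \<longrightarrow>
        D (X + Y) Z = D X Z + D Y Z \<and> D X (Y + Z) = D X Y + D X Z) \<and>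
     (\<forall>f X Y. smooth M f \<longrightarrow> vector_field M X \<longrightarrow> vector_field M Y \<longrightarrow>
        D (fmult f X) Y = fmult f (D X Y) \<and>
        D X (fmult f Y) = fmult (ddir X f) Y + fmult f (D X Y))"

definition torsion :: "'a connection \<Rightarrow> 'a vfield \<Rightarrow> 'a vfield \<Rightarrow> 'a vfield" where
  "torsion D X Y = D X Y - D Y X - lie_bracket X Y"

definition torsion3 ::
  "'a tensor02 \<Rightarrow> 'a connection \<Rightarrow> 'a vfield \<Rightarrow> 'a vfield \<Rightarrow> 'a vfield \<Rightarrow> 'a \<Rightarrow> real" where
  "torsion3 g D X Y Z = app02 g (torsion D X Y) Z"

text \<open>Covariant derivatives of 1-forms and of (0,2)-tensors.\<close>

definition cov01 :: "'a connection \<Rightarrow> 'a tensor01 \<Rightarrow> 'a vfield \<Rightarrow> 'a vfield \<Rightarrow> 'a \<Rightarrow> real" where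
  "cov01 D \<eta> X Y = ddir X (app01 \<eta> Y) - app01 \<eta> (D X Y)"

definition cov02 ::
  "'a connection \<Rightarrow> 'a tensor02 \<Rightarrow> 'a vfield \<Rightarrow> 'a vfield \<Rightarrow> 'a vfield \<Rightarrow> 'a \<Rightarrow> real" where
  "cov02 D G X Y Z = ddir X (app02 G Y Z) - app02 G (D X Y) Z - app02 G Y (D X Z)"

definition parallel02 ::
  "('a, 'e::euclidean_space) chart set \<Rightarrow> 'a connection \<Rightarrow> 'a tensor02 \<Rightarrow> bool" where
  "parallel02 M D G \<longleftrightarrow>
     (\<forall>X Y Z. vector_field M X \<longrightarrow> vector_field M Y \<longrightarrow> vector_field M Z \<longrightarrow> cov02 D G X Y Z = 0)"

text \<open>
  Invariance up to sign under the two adjacent transpositions is total skew-symmetry.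
\<close>

definition totally_skew ::
  "('a, 'e::euclidean_space) chart set \<Rightarrow> ('a vfield \<Rightarrow> 'a vfield \<Rightarrow> 'a vfield \<Rightarrow> 'a \<Rightarrow> real) \<Rightarrow> bool"
where
  "totally_skew M S \<longleftrightarrow>
     (\<forall>X Y Z. vector_field M X \<longrightarrow> vector_field M Y \<longrightarrow> vector_field M Z \<longrightarrow>
        S Y X Z = - S X Y Z \<and> S X Z Y = - S X Y Z)"

definition levi_civita ::
  "('a, 'e::euclidean_space) chart set \<Rightarrow> 'a tensor02 \<Rightarrow> 'a connection \<Rightarrow> bool" where
  "levi_civita M g D \<longleftrightarrow>
     linear_connection M D \<and> parallel02 M D g \<and>
     (\<forall>X Y. vector_field M X \<longrightarrow> vector_field M Y \<longrightarrow> torsion D X Y = 0)"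

definition geodesic_field :: "'a connection \<Rightarrow> 'a vfield \<Rightarrow> bool" where
  "geodesic_field Dg X \<longleftrightarrow> Dg X X = 0"

text \<open>Here \<open>Dg\<close> is the Levi-Civita connection of g.\<close>

definition killing_field ::
  "('a, 'e::euclidean_space) chart set \<Rightarrow> 'a tensor02 \<Rightarrow> 'a connection \<Rightarrow> 'a vfield \<Rightarrow> bool" where
  "killing_field M g Dg Z \<longleftrightarrow>
     (\<forall>X Y. vector_field M X \<longrightarrow> vector_field M Y \<longrightarrow>
        app02 g (Dg X Z) Y + app02 g (Dg Y Z) X = 0)"


section \<open>Weak almost contact metric manifolds\<close>

definition weak_almost_contact_metric ::
  "('a::{t2_space, second_countable_topology}, 'e::euclidean_space) chart set \<Rightarrow> nat \<Rightarrow>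
    'a tensor11 \<Rightarrow> 'a tensor11 \<Rightarrow> 'a tensor01 \<Rightarrow> 'a vfield \<Rightarrow> 'a tensor02 \<Rightarrow> bool" where
  "weak_almost_contact_metric M m A Q \<eta> \<xi> g \<longleftrightarrow>
     smooth_manifold M \<and> DIM('e) = 2 * m + 1 \<and>
     riemannian_metric M g \<and> tensor11 M A \<and> tensor11 M Q \<and> one_form M \<eta> \<and> vector_field M \<xi> \<and>
     (\<forall>p. dim (A p ` tangent_space M p) = 2 * m) \<and>
     (\<forall>p. \<forall>v\<in>tangent_space M p. \<forall>w\<in>tangent_space M p. g p (A p v) w = - g p v (A p w)) \<and>
     (\<forall>p. bij_betw (Q p) (tangent_space M p) (tangent_space M p)) \<and>
     (\<exists>p. \<exists>v\<in>tangent_space M p. Q p v \<noteq> v) \<and>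
     (\<forall>p. \<forall>v\<in>tangent_space M p. \<eta> p v = g p v (\<xi> p)) \<and>
     (\<forall>p. \<eta> p (\<xi> p) = 1) \<and>
     (\<forall>p. \<forall>v\<in>tangent_space M p. A p (A p v) = - Q p v + \<eta> p v *\<^sub>R \<xi> p) \<and>
     (\<forall>p. \<forall>v\<in>tangent_space M p. \<forall>w\<in>tangent_space M p.
        g p (A p v) (A p w) = g p (Q p v) w - \<eta> p v * \<eta> p w) \<and>
     (\<forall>p. A p (\<xi> p) = 0) \<and> (\<forall>p. Q p (\<xi> p) = \<xi> p)"

definition fundamental_form :: "'a tensor02 \<Rightarrow> 'a tensor11 \<Rightarrow> 'a tensor02" where
  "fundamental_form g A = (\<lambda>p v w. g p (A p v) w)"

text \<open>The connection preserves the generalized metric G = g + F.\<close>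

definition generalized_metric_connection ::
  "('a, 'e::euclidean_space) chart set \<Rightarrow> 'a tensor02 \<Rightarrow> 'a tensor02 \<Rightarrow> 'a connection \<Rightarrow> bool" where
  "generalized_metric_connection M g F D \<longleftrightarrow> linear_connection M D \<and> parallel02 M D (g + F)"

definition Q_torsion_condition ::
  "('a, 'e::euclidean_space) chart set \<Rightarrow> 'a tensor11 \<Rightarrow> 'a connection \<Rightarrow> bool" where
  "Q_torsion_condition M Q D \<longleftrightarrow>
     (\<forall>X Y. vector_field M X \<longrightarrow> vector_field M Y \<longrightarrow>
        torsion D (app11 Q X) Y = torsion D X (app11 Q Y) \<and>
        torsion D X (app11 Q Y) = app11 Q (torsion D X Y))"

definition nijenhuis :: "'a tensor11 \<Rightarrow> 'a vfield \<Rightarrow> 'a vfield \<Rightarrow> 'a vfield" where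
  "nijenhuis A X Y =
     lie_bracket (app11 A X) (app11 A Y) + app11 A (app11 A (lie_bracket X Y))
     - app11 A (lie_bracket (app11 A X) Y) - app11 A (lie_bracket X (app11 A Y))"

text \<open>
  The exterior derivative in the normalization without the factor 1/2, for
  \<open>Dg\<close> the Levi-Civita connection.
\<close>

definition ext_deriv :: "'a connection \<Rightarrow> 'a tensor01 \<Rightarrow> 'a vfield \<Rightarrow> 'a vfield \<Rightarrow> 'a \<Rightarrow> real" where
  "ext_deriv Dg \<eta> X Y = cov01 Dg \<eta> X Y - cov01 Dg \<eta> Y X"

definition nijenhuis_wac ::
  "'a tensor02 \<Rightarrow> 'a connection \<Rightarrow> 'a tensor11 \<Rightarrow> 'a tensor01 \<Rightarrow>
    'a vfield \<Rightarrow> 'a vfield \<Rightarrow> 'a vfield \<Rightarrow> 'a \<Rightarrow> real" where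
  "nijenhuis_wac g Dg A \<eta> X Y Z =
     app02 g (nijenhuis A X Y) Z + ext_deriv Dg \<eta> X Y * app01 \<eta> Z"

end

theory Submission
  imports Defs
begin

text \<open>
  Write \<open>T(X,Y,Z) = g(T(X,Y),Z)\<close> for the torsion of \<open>D\<close>. The whole argument is algebra with this
  3-form, once two facts are known.

  First, \<open>D\<close> preserves \<open>g\<close> and \<open>F\<close>, the symmetric and skew parts of \<open>G\<close>, hence it commutes with
  \<open>A\<close>, because \<open>F(Y,Z) = g(AY,Z)\<close>. Applied to \<open>A\<xi> = 0\<close> this puts \<open>D\<^sub>X\<xi>\<close> into the kernel of \<open>A\<close>. That
  kernel is spanned by \<open>\<xi>\<close>, whereas \<open>D\<^sub>X\<xi>\<close> is orthogonal to \<open>\<xi>\<close> since \<open>\<xi>\<close> has unit length. So \<open>\<xi>\<close> is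
  \<open>D\<close>-parallel (lemma \<open>parallel_\<xi>\<close>).

  Second, a metric connection with skew-symmetric torsion differs from the Levi-Civita connection by
  \<open>T/2\<close> (lemma \<open>skew_torsion_connection_eq\<close>). With \<open>D\<xi> = 0\<close> this gives
  \<open>g(\<nabla>\<^sup>g\<^sub>X \<xi>, Y) = - T(X,\<xi>,Y)/2\<close>, which is skew in \<open>X\<close> and \<open>Y\<close> and vanishes for \<open>X = \<xi>\<close>. This is
  part i).

  For part ii), replace every Lie bracket in the Nijenhuis tensor by
  \<open>[X,Y] = D\<^sub>X Y - D\<^sub>Y X - T(X,Y)\<close>. Since \<open>D\<close> commutes with \<open>A\<close>, all covariant derivatives cancel.
  The square \<open>A\<^sup>2 = - Q + \<eta> \<otimes> \<xi>\<close> contributes \<open>T(X,Y,QZ) - T(X,Y,\<xi>) \<eta>(Z)\<close>, and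
  \<open>d\<eta>(X,Y) = T(X,Y,\<xi>)\<close>, so that adding \<open>d\<eta> \<otimes> \<eta>\<close> removes exactly the second term. The result is
  (lemma \<open>nijenhuis_wac_eq\<close>)

    \<open>N(X,Y,Z) = T(X,Y,QZ) - (T(AX,AY,Z) + T(AX,Y,AZ) + T(X,AY,AZ))\<close>.

  The bracketed sum is totally skew for every 3-form \<open>T\<close>, and \<open>T(X,Y,QZ)\<close> is skew in \<open>X\<close> and \<open>Y\<close>. Hence \<open>N\<close> is
  totally skew iff \<open>T(X,QY,Z) = T(X,Y,QZ)\<close>, and as \<open>Q\<close> is \<open>g\<close>-symmetric this is the
  \<open>Q\<close>-torsion condition.
\<close>


section \<open>Smooth functions, tangent vectors and vector fields\<close>

lemma scaleR_fun_apply: "(c *\<^sub>R f) x = c *\<^sub>R f x"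
  by (simp add: scaleR_fun_def)

lemma Ck_on_linear_combination:
  assumes "Ck_on k S f" "Ck_on k S h"
  shows "Ck_on k S (\<lambda>x. a *\<^sub>R f x + b *\<^sub>R h x)"
  using assms
proof (induction k arbitrary: f h)
  case 0
  then show ?case by (auto intro!: continuous_intros)
next
  case (Suc k)
  then obtain Df Dh where
    "\<And>x. x \<in> S \<Longrightarrow> (f has_derivative Df x) (at x)" "\<And>v. Ck_on k S (\<lambda>x. Df x v)"
    "\<And>x. x \<in> S \<Longrightarrow> (h has_derivative Dh x) (at x)" "\<And>v. Ck_on k S (\<lambda>x. Dh x v)"
    unfolding Ck_on.simps by blast
  with Suc.IH show ?case
    by (auto intro!: exI[of _ "\<lambda>x v. a *\<^sub>R Df x v + b *\<^sub>R Dh x v"] derivative_intros)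
qed

lemma smooth_linear_combination:
  assumes "smooth M f" "smooth M h"
  shows "smooth M (a *\<^sub>R f + b *\<^sub>R h)"
  unfolding smooth_def smooth_on_def
proof clarify
  fix U \<phi> k assume "(U, \<phi>) \<in> M"
  then have "Ck_on k (\<phi> ` U) (\<lambda>x. a *\<^sub>R (f \<circ> inv_into U \<phi>) x + b *\<^sub>R (h \<circ> inv_into U \<phi>) x)"
    using assms unfolding smooth_def smooth_on_def by (intro Ck_on_linear_combination) blast+
  then show "Ck_on k (\<phi> ` U) ((a *\<^sub>R f + b *\<^sub>R h) \<circ> inv_into U \<phi>)"
    by (simp add: comp_def scaleR_fun_apply)
qed

lemma tangent_space_linear_combination:
  "v \<in> tangent_space M p \<Longrightarrow> w \<in> tangent_space M p \<Longrightarrow> a *\<^sub>R v + b *\<^sub>R w \<in> tangent_space M p"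
  unfolding tangent_space_def mem_Collect_eq plus_fun_apply scaleR_fun_apply
  by (simp add: algebra_simps)

lemma vector_field_linear_combination:
  assumes "vector_field M X" "vector_field M Y"
  shows "vector_field M (a *\<^sub>R X + b *\<^sub>R Y)"
proof -
  have "ddir (a *\<^sub>R X + b *\<^sub>R Y) f = a *\<^sub>R ddir X f + b *\<^sub>R ddir Y f" for f
    by (simp add: ddir_def scaleR_fun_apply fun_eq_iff)
  moreover have "(a *\<^sub>R X + b *\<^sub>R Y) p = a *\<^sub>R X p + b *\<^sub>R Y p" for p
    by (simp add: scaleR_fun_apply fun_eq_iff)
  ultimately show ?thesis
    using assms by (simp add: vector_field_def tangent_space_linear_combination smooth_linear_combination)
qed

lemma vector_field_add: "vector_field M X \<Longrightarrow> vector_field M Y \<Longrightarrow> vector_field M (X + Y)"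
  using vector_field_linear_combination[of M X Y 1 1] by simp

lemma vector_field_diff: "vector_field M X \<Longrightarrow> vector_field M Y \<Longrightarrow> vector_field M (X - Y)"
  using vector_field_linear_combination[of M X Y 1 "-1"] by simp

lemma vector_field_tangent: "vector_field M X \<Longrightarrow> X p \<in> tangent_space M p"
  by (simp add: vector_field_def)

lemma ddir_add:
  "vector_field M X \<Longrightarrow> smooth M f \<Longrightarrow> smooth M h \<Longrightarrow> ddir X (f + h) = ddir X f + ddir X h"
  unfolding vector_field_def tangent_space_def ddir_def fun_eq_iff plus_fun_apply by blast

lemma ddir_uminus:
  assumes "vector_field M X" "smooth M f"
  shows "ddir X (- f) = - ddir X f"
proof -
  have "X p ((-1) *\<^sub>R f) = (-1) * X p f" for p
    using assms unfolding vector_field_def tangent_space_def by blast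
  then show "ddir X (- f) = - ddir X f"
    unfolding ddir_def fun_eq_iff uminus_apply scaleR_minus1_left by simp
qed

lemma ddir_one:
  assumes "vector_field M X" "smooth M 1"
  shows "ddir X 1 = 0"
proof
  fix p
  \<comment> \<open>The Leibniz rule for \<open>1 = 1 * 1\<close> reads \<open>X 1 = 2 (X 1)\<close>.\<close>
  have "X p (1 * 1) = X p 1 * 1 p + 1 p * X p 1"
    using assms unfolding vector_field_def tangent_space_def by blast
  then show "ddir X 1 p = 0 p" by (simp add: ddir_def)
qed

lemma vector_field_app11: "tensor11 M A \<Longrightarrow> vector_field M X \<Longrightarrow> vector_field M (app11 A X)"
  by (simp add: tensor11_def)

lemma vector_field_connection:
  "linear_connection M D \<Longrightarrow> vector_field M X \<Longrightarrow> vector_field M Y \<Longrightarrow> vector_field M (D X Y)"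
  by (simp add: linear_connection_def)

lemma connection_zero_right:
  assumes "linear_connection M D" "vector_field M X" "vector_field M 0"
  shows "D X 0 = 0"
proof -
  have "D X (0 + 0) = D X 0 + D X 0"
    using assms unfolding linear_connection_def by blast
  then show ?thesis by simp
qed

lemma lie_bracket_torsion: "lie_bracket X Y = D X Y - D Y X - torsion D X Y"
  by (simp add: torsion_def)


section \<open>Metric connections with skew-symmetric torsion\<close>

locale riemannian =
  fixes M :: "('a, 'e::euclidean_space) chart set" and g :: "'a tensor02"
  assumes metric: "riemannian_metric M g"
begin

abbreviation vf :: "'a vfield \<Rightarrow> bool" where "vf \<equiv> vector_field M"

lemma metric_sym: "vf X \<Longrightarrow> vf Y \<Longrightarrow> app02 g X Y = app02 g Y X"
  using metric by (simp add: riemannian_metric_def app02_def vector_field_tangent)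

lemma smooth_metric: "vf X \<Longrightarrow> vf Y \<Longrightarrow> smooth M (app02 g X Y)"
  using metric by (simp add: riemannian_metric_def tensor02_def)

lemma metric_add:
  "vf X \<Longrightarrow> vf Y \<Longrightarrow> vf Z \<Longrightarrow> app02 g (X + Y) Z = app02 g X Z + app02 g Y Z"
  using metric
  by (simp add: riemannian_metric_def tensor02_def app02_def vector_field_tangent fun_eq_iff)

lemma metric_diff:
  assumes "vf X" "vf Y" "vf Z"
  shows "app02 g (X - Y) Z = app02 g X Z - app02 g Y Z"
  using metric_add[of "X - Y" Y Z] assms by (simp add: vector_field_diff)

lemma metric_zero: "vf Y \<Longrightarrow> app02 g 0 Y = 0"
  using metric_diff[of Y Y Y] by simp

text \<open>
  Testing against the field \<open>X - Y\<close> itself makes positivity of \<open>g\<close> apply at every point at once, so no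
  tangent vector has to be extended to a global vector field.
\<close>

lemma metric_nondegenerate:
  assumes "vf X" "vf Y" "\<And>Z. vf Z \<Longrightarrow> app02 g X Z = app02 g Y Z"
  shows "X = Y"
proof -
  let ?W = "X - Y"
  have W: "vf ?W" using assms by (simp add: vector_field_diff)
  have "app02 g ?W ?W = 0" using assms W by (simp add: metric_diff)
  then have "g p (?W p) (?W p) = 0" for p by (auto simp: app02_def fun_eq_iff)
  then have "?W p = 0" for p
    using metric vector_field_tangent[OF W, of p]
    unfolding riemannian_metric_def by (metis less_irrefl)
  then show ?thesis by (simp add: fun_eq_iff)
qed

lemma metric_connection:
  assumes "parallel02 M D g" "vf X" "vf Y" "vf Z"
  shows "ddir X (app02 g Y Z) = app02 g (D X Y) Z + app02 g Y (D X Z)"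
  using assms by (simp add: parallel02_def cov02_def algebra_simps)

text \<open>
  That the bracket is again a derivation would require the smoothness of products of functions. A
  torsion-free connection gives a shorter way: the bracket is \<open>\<nabla>\<^sup>g\<^sub>X Y - \<nabla>\<^sup>g\<^sub>Y X\<close>, a difference of
  vector fields.
\<close>

lemma vector_field_lie_bracket:
  assumes "levi_civita M g Dg" "vf X" "vf Y"
  shows "vf (lie_bracket X Y)"
proof -
  have "lie_bracket X Y = Dg X Y - Dg Y X"
    using assms lie_bracket_torsion[of X Y Dg] by (simp add: levi_civita_def)
  then show ?thesis
    using assms by (simp add: levi_civita_def vector_field_diff vector_field_connection)
qed

lemma vector_field_torsion:
  assumes "levi_civita M g Dg" "linear_connection M D" "vf X" "vf Y"
  shows "vf (torsion D X Y)"
  using assms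
  by (simp add: torsion_def vector_field_diff vector_field_connection vector_field_lie_bracket)

text \<open>
  The difference \<open>S(U,V,W) = g(D\<^sub>U V - \<nabla>\<^sup>g\<^sub>U V, W)\<close> is skew in \<open>V, W\<close> because both connections are
  metric, and \<open>S(U,V,W) - S(V,U,W) = T(U,V,W)\<close> because only \<open>D\<close> has torsion. As in the Koszul formula these
  two symmetries determine \<open>S\<close>, by
  \<open>2 S(X,Y,Z) = T(X,Y,Z) - T(Y,Z,X) + T(Z,X,Y)\<close>. For skew \<open>T\<close> the right-hand side is \<open>T(X,Y,Z)\<close>.
\<close>

lemma skew_torsion_connection_eq:
  assumes lc: "levi_civita M g Dg" and D: "linear_connection M D" "parallel02 M D g"
    and skew: "totally_skew M (torsion3 g D)"
    and vf: "vf X" "vf Y" "vf Z"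
  shows "app02 g (Dg X Y) Z p = app02 g (D X Y) Z p - torsion3 g D X Y Z p / 2"
proof -
  define S where "S U V W = app02 g (D U V) W p - app02 g (Dg U V) W p" for U V W
  have Dg: "linear_connection M Dg" "parallel02 M Dg g"
    using lc by (auto simp: levi_civita_def)
  have anti: "S U V W = - S U W V" if "vf U" "vf V" "vf W" for U V W
    using fun_cong[OF metric_connection[OF D(2) that], of p]
      fun_cong[OF metric_connection[OF Dg(2) that], of p]
      metric_sym[of V "D U W"] metric_sym[of V "Dg U W"] that
    by (simp add: S_def vector_field_connection D Dg)
  have tors: "S U V W - S V U W = torsion3 g D U V W p" if "vf U" "vf V" "vf W" for U V W
  proof -
    have "torsion D U V = (D U V - D V U) - (Dg U V - Dg V U)"
      using lc that lie_bracket_torsion[of U V Dg] by (simp add: levi_civita_def torsion_def)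
    then show ?thesis
      using that by (simp add: S_def torsion3_def metric_diff vector_field_diff
          vector_field_connection D Dg)
  qed
  have T: "torsion3 g D Y Z X p = torsion3 g D X Y Z p"
    "torsion3 g D Z X Y p = torsion3 g D X Y Z p"
    using skew vf unfolding totally_skew_def by (metis uminus_apply minus_minus)+
  have "2 * S X Y Z = torsion3 g D X Y Z p"
    using anti[OF vf(1,2,3)] anti[OF vf(2,1,3)] anti[OF vf(3,1,2)]
      tors[OF vf(1,2,3)] tors[OF vf(2,3,1)] tors[OF vf(3,1,2)] T
    by linarith
  then show ?thesis
    by (simp add: S_def)
qed

end


section \<open>Weak almost contact metric manifolds\<close>

locale weak_acm =
  fixes M :: "('a::{t2_space, second_countable_topology}, 'e::euclidean_space) chart set"
    and m :: nat
    and A Q :: "'a tensor11" and \<eta> :: "'a tensor01" and \<xi> :: "'a vfield" and g :: "'a tensor02"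
  assumes wacm: "weak_almost_contact_metric M m A Q \<eta> \<xi> g"

sublocale weak_acm \<subseteq> riemannian M g
  using wacm by unfold_locales (simp add: weak_almost_contact_metric_def)

context weak_acm
begin

lemma vf_A: "vf X \<Longrightarrow> vf (app11 A X)"
  and vf_Q: "vf X \<Longrightarrow> vf (app11 Q X)"
  and vf_\<xi>: "vf \<xi>"
  using wacm by (simp_all add: weak_almost_contact_metric_def vector_field_app11)

lemma metric_A: "vf X \<Longrightarrow> vf Y \<Longrightarrow> app02 g (app11 A X) Y = - app02 g X (app11 A Y)"
  using wacm
  by (simp add: weak_almost_contact_metric_def app02_def app11_def vector_field_tangent fun_eq_iff)

lemma \<eta>_eq: "vf X \<Longrightarrow> app01 \<eta> X = app02 g X \<xi>"
  using wacm
  by (simp add: weak_almost_contact_metric_def app02_def app01_def vector_field_tangent fun_eq_iff)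

lemma metric_\<xi>_\<xi>: "app02 g \<xi> \<xi> = 1"
proof -
  have "app01 \<eta> \<xi> = 1"
    using wacm by (simp add: weak_almost_contact_metric_def app01_def fun_eq_iff)
  then show ?thesis by (simp add: \<eta>_eq vf_\<xi>)
qed

lemma A_\<xi>: "app11 A \<xi> = 0"
  using wacm by (simp add: weak_almost_contact_metric_def app11_def fun_eq_iff)

lemma vf_zero: "vf 0"
  using vf_A[OF vf_\<xi>] by (simp add: A_\<xi>)

lemma metric_Q:
  assumes "vf X" "vf Y"
  shows "app02 g (app11 Q X) Y = app02 g (app11 A X) (app11 A Y) + app01 \<eta> X * app01 \<eta> Y"
  using wacm assms
  by (simp add: weak_almost_contact_metric_def app02_def app11_def app01_def
      vector_field_tangent fun_eq_iff)

text \<open>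
  \<open>g(QX,Y) = g(AX,AY) + \<eta>(X) \<eta>(Y)\<close> is visibly symmetric in \<open>X\<close> and \<open>Y\<close>.
\<close>

lemma Q_symmetric:
  assumes "vf X" "vf Y"
  shows "app02 g (app11 Q X) Y = app02 g X (app11 Q Y)"
  using metric_Q[of X Y] metric_Q[of Y X] metric_sym[of "app11 A X" "app11 A Y"]
    metric_sym[of "app11 Q Y" X] assms
  by (simp add: vf_A vf_Q mult.commute)

text \<open>
  If \<open>Av = 0\<close>, then \<open>0 = A\<^sup>2 v\<close> says \<open>Qv = \<eta>(v) \<xi> = Q(\<eta>(v) \<xi>)\<close>, and \<open>Q\<close> is injective.
\<close>

lemma A_kernel:
  assumes v: "v \<in> tangent_space M p" and Av: "A p v = 0"
  shows "v = \<eta> p v *\<^sub>R \<xi> p"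
proof -
  have tA: "tensor11 M A" and tQ: "tensor11 M Q" and inj: "inj_on (Q p) (tangent_space M p)"
    and sq: "A p (A p v) = - Q p v + \<eta> p v *\<^sub>R \<xi> p" and Q\<xi>: "Q p (\<xi> p) = \<xi> p"
    using wacm v by (auto simp: weak_almost_contact_metric_def bij_betw_def)
  have \<xi>: "\<xi> p \<in> tangent_space M p"
    using vf_\<xi> by (rule vector_field_tangent)
  \<comment> \<open>Homogeneity with factor \<open>0\<close> yields \<open>A 0 = 0\<close>.\<close>
  have "A p (0 *\<^sub>R v) = 0 *\<^sub>R A p v"
    using tA v unfolding tensor11_def by blast
  then have "Q p v = \<eta> p v *\<^sub>R \<xi> p"
    using sq Av by simp
  also have "\<dots> = Q p (\<eta> p v *\<^sub>R \<xi> p)"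
    using tQ \<xi> Q\<xi> by (simp add: tensor11_def)
  finally show ?thesis
    using inj v \<xi> tangent_space_linear_combination[OF \<xi> \<xi>, of "\<eta> p v" 0]
    by (auto dest: inj_onD)
qed

end


section \<open>Generalized metric connections with skew-symmetric torsion\<close>

locale weak_acm_skew_torsion = weak_acm +
  fixes D Dg :: "'a connection"
  assumes lc: "levi_civita M g Dg"
    and gmc: "generalized_metric_connection M g (fundamental_form g A) D"
    and skew: "totally_skew M (torsion3 g D)"
begin

abbreviation T where "T \<equiv> torsion3 g D"

lemma connection_D: "linear_connection M D"
  using gmc by (simp add: generalized_metric_connection_def)

lemma vf_D: "vf X \<Longrightarrow> vf Y \<Longrightarrow> vf (D X Y)"
  by (rule vector_field_connection[OF connection_D])

lemma vf_lie_bracket: "vf X \<Longrightarrow> vf Y \<Longrightarrow> vf (lie_bracket X Y)"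
  by (rule vector_field_lie_bracket[OF lc])

lemma vf_torsion: "vf X \<Longrightarrow> vf Y \<Longrightarrow> vf (torsion D X Y)"
  by (rule vector_field_torsion[OF lc connection_D])

lemmas vf_intros = vf_A vf_Q vf_\<xi> vf_D vf_lie_bracket vf_torsion vector_field_add vector_field_diff

lemma T_skew:
  assumes "vf X" "vf Y" "vf Z"
  shows "T Y X Z p = - T X Y Z p" "T X Z Y p = - T X Y Z p"
  using skew assms unfolding totally_skew_def by (metis uminus_apply)+

lemma parallel_G:
  assumes "vf X" "vf Y" "vf Z"
  shows "ddir X (app02 g Y Z) + ddir X (app02 g (app11 A Y) Z) =
    app02 g (D X Y) Z + app02 g Y (D X Z) +
    app02 g (app11 A (D X Y)) Z + app02 g (app11 A Y) (D X Z)"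
proof -
  have G: "app02 (g + fundamental_form g A) U V = app02 g U V + app02 g (app11 A U) V" for U V
    by (simp add: app02_def fundamental_form_def app11_def fun_eq_iff)
  have "cov02 D (g + fundamental_form g A) X Y Z = 0"
    using gmc assms by (simp add: generalized_metric_connection_def parallel02_def)
  then show ?thesis
    using assms
    by (simp add: cov02_def G ddir_add[of M] smooth_metric vf_A algebra_simps)
qed

text \<open>
  Swapping \<open>Y\<close> and \<open>Z\<close> in \<open>parallel_G\<close> preserves the terms in \<open>g\<close> and reverses the sign of those in \<open>F\<close>.
  Half the sum and half the difference of the two equations separate the two parts.
\<close>

lemma parallel_g: "parallel02 M D g"
  and parallel_F: "vf X \<Longrightarrow> vf Y \<Longrightarrow> vf Z \<Longrightarrow> ddir X (app02 g (app11 A Y) Z) =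
    app02 g (app11 A (D X Y)) Z + app02 g (app11 A Y) (D X Z)"
proof -
  have both: "cov02 D g X Y Z = 0 \<and> ddir X (app02 g (app11 A Y) Z) =
      app02 g (app11 A (D X Y)) Z + app02 g (app11 A Y) (D X Z)"
    if vf: "vf X" "vf Y" "vf Z" for X Y Z
  proof -
    have F: "app02 g (app11 A U) V = - app02 g (app11 A V) U" if "vf U" "vf V" for U V
      using metric_A[OF that] metric_sym[OF that(1) vf_A[OF that(2)]] by simp
    have ddF: "ddir X (app02 g (app11 A Z) Y) = - ddir X (app02 g (app11 A Y) Z)"
      using ddir_uminus[OF vf(1) smooth_metric[OF vf_A[OF vf(2)] vf(3)]] F[OF vf(3,2)] by simp
    have flip: "app02 g Z Y = app02 g Y Z" "app02 g (D X Z) Y = app02 g Y (D X Z)"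
      "app02 g Z (D X Y) = app02 g (D X Y) Z"
      "app02 g (app11 A (D X Z)) Y = - app02 g (app11 A Y) (D X Z)"
      "app02 g (app11 A Z) (D X Y) = - app02 g (app11 A (D X Y)) Z"
      using vf by (auto intro: metric_sym F vf_D)
    have yz: "ddir X (app02 g Y Z) p + ddir X (app02 g (app11 A Y) Z) p =
        app02 g (D X Y) Z p + app02 g Y (D X Z) p +
        app02 g (app11 A (D X Y)) Z p + app02 g (app11 A Y) (D X Z) p" for p
      using fun_cong[OF parallel_G[OF vf(1,2,3)], of p] by simp
    have zy: "ddir X (app02 g Y Z) p - ddir X (app02 g (app11 A Y) Z) p =
        app02 g (D X Y) Z p + app02 g Y (D X Z) p -
        app02 g (app11 A (D X Y)) Z p - app02 g (app11 A Y) (D X Z) p" for p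
      using fun_cong[OF parallel_G[OF vf(1,3,2)], of p] by (simp add: ddF flip)
    have "ddir X (app02 g Y Z) p = app02 g (D X Y) Z p + app02 g Y (D X Z) p"
      "ddir X (app02 g (app11 A Y) Z) p =
        app02 g (app11 A (D X Y)) Z p + app02 g (app11 A Y) (D X Z) p" for p
      using yz[of p] zy[of p] by linarith+
    then show ?thesis
      by (simp add: cov02_def fun_eq_iff)
  qed
  show "parallel02 M D g"
    using both by (simp add: parallel02_def)
  show "vf X \<Longrightarrow> vf Y \<Longrightarrow> vf Z \<Longrightarrow> ddir X (app02 g (app11 A Y) Z) =
      app02 g (app11 A (D X Y)) Z + app02 g (app11 A Y) (D X Z)"
    using both by blast
qed

text \<open>
  Expanding the derivative of \<open>F(Y,Z) = g(AY,Z)\<close> once by \<open>D F = 0\<close> and once by \<open>D g = 0\<close> leaves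
  \<open>g(D\<^sub>X(AY), Z) = g(A(D\<^sub>X Y), Z)\<close>.
\<close>

lemma parallel_A:
  assumes "vf X" "vf Y"
  shows "D X (app11 A Y) = app11 A (D X Y)"
proof (rule metric_nondegenerate)
  show "app02 g (D X (app11 A Y)) Z = app02 g (app11 A (D X Y)) Z" if "vf Z" for Z
    using metric_connection[OF parallel_g, of X "app11 A Y" Z] parallel_F[of X Y Z] assms that
    by (simp add: vf_A)
qed (simp_all add: assms vf_intros)

text \<open>
  \<open>D\<^sub>X \<xi>\<close> lies in the kernel of \<open>A\<close>, hence is a multiple of \<open>\<xi>\<close>, and it is orthogonal to \<open>\<xi>\<close>.
\<close>

lemma parallel_\<xi>:
  assumes X: "vf X"
  shows "D X \<xi> = 0"
proof
  fix p
  have "smooth M (1 :: 'a \<Rightarrow> real)"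
    using smooth_metric[OF vf_\<xi> vf_\<xi>] by (simp add: metric_\<xi>_\<xi>)
  then have "app02 g (D X \<xi>) \<xi> + app02 g \<xi> (D X \<xi>) = 0"
    using metric_connection[OF parallel_g X vf_\<xi> vf_\<xi>] ddir_one[OF X] by (simp add: metric_\<xi>_\<xi>)
  then have orth: "app01 \<eta> (D X \<xi>) p = 0"
    using X by (simp add: \<eta>_eq metric_sym[of \<xi> "D X \<xi>"] vf_intros fun_eq_iff)
  have "app11 A (D X \<xi>) = 0"
    using parallel_A[OF X vf_\<xi>] connection_zero_right[OF connection_D X vf_zero] by (simp add: A_\<xi>)
  then have "A p (D X \<xi> p) = 0"
    by (metis app11_def zero_fun_apply)
  from A_kernel[OF _ this] orth show "D X \<xi> p = 0 p"
    using vector_field_tangent[OF vf_D[OF X vf_\<xi>]] by (simp add: app01_def)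
qed

lemma levi_civita_\<xi>:
  assumes "vf X" "vf Y"
  shows "app02 g (Dg X \<xi>) Y p = - T X \<xi> Y p / 2"
  using skew_torsion_connection_eq[OF lc connection_D parallel_g skew assms(1) vf_\<xi> assms(2)]
  by (simp add: parallel_\<xi> metric_zero assms)

lemma killing_\<xi>: "killing_field M g Dg \<xi>"
  unfolding killing_field_def
proof (intro allI impI ext)
  fix X Y p assume vf: "vf X" "vf Y"
  then show "(app02 g (Dg X \<xi>) Y + app02 g (Dg Y \<xi>) X) p = 0 p"
    using T_skew(2)[of X \<xi> Y p] T_skew(1)[of X Y \<xi> p] T_skew(2)[of Y \<xi> X p]
    by (simp add: levi_civita_\<xi> vf_\<xi>)
qed

lemma geodesic_\<xi>: "geodesic_field Dg \<xi>"
  unfolding geodesic_field_def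
proof (rule metric_nondegenerate)
  show "vf (Dg \<xi> \<xi>)"
    using lc vf_\<xi> by (simp add: levi_civita_def vector_field_connection)
  show "vf 0" by (rule vf_zero)
  show "app02 g (Dg \<xi> \<xi>) Z = app02 g 0 Z" if "vf Z" for Z
    using that T_skew(1)[OF vf_\<xi> vf_\<xi> that]
    by (simp add: fun_eq_iff levi_civita_\<xi> vf_\<xi> metric_zero)
qed

lemma metric_lie_bracket:
  assumes "vf X" "vf Y" "vf Z"
  shows "app02 g (lie_bracket X Y) Z = app02 g (D X Y) Z - app02 g (D Y X) Z - T X Y Z"
  using assms
  by (simp add: lie_bracket_torsion[of X Y D] torsion3_def metric_diff vf_intros)

text \<open>
  The \<open>D\<close>-parallel form \<open>\<eta>\<close> satisfies \<open>X(\<eta>(Y)) = \<eta>(D\<^sub>X Y)\<close>, so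
  \<open>(\<nabla>\<^sup>g\<^sub>X \<eta>)(Y) = \<eta>(D\<^sub>X Y - \<nabla>\<^sup>g\<^sub>X Y) = T(X,Y,\<xi>)/2\<close>; skew-symmetrizing doubles it.
\<close>

lemma ext_deriv_\<eta>:
  assumes "vf X" "vf Y"
  shows "ext_deriv Dg \<eta> X Y p = T X Y \<xi> p"
proof -
  have D\<eta>: "ddir U (app01 \<eta> V) = app02 g (D U V) \<xi>" if "vf U" "vf V" for U V
  proof -
    have "app02 g V 0 = 0"
      using metric_sym[OF that(2) vf_zero] that by (simp add: metric_zero)
    then show ?thesis
      using metric_connection[OF parallel_g that vf_\<xi>] that by (simp add: \<eta>_eq parallel_\<xi>)
  qed
  have vfg: "vf (Dg X Y)" "vf (Dg Y X)"
    using lc assms by (simp_all add: levi_civita_def vector_field_connection)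
  show ?thesis
    using assms vfg T_skew[of X Y \<xi> p]
    by (simp add: ext_deriv_def cov01_def D\<eta> \<eta>_eq[OF vfg(1)] \<eta>_eq[OF vfg(2)]
        skew_torsion_connection_eq[OF lc connection_D parallel_g skew] vf_\<xi>)
qed

text \<open>
  Moving each outer \<open>A\<close> to the last slot by skew-symmetry turns \<open>g(N\<^sub>A(X,Y),Z)\<close> into
  \<open>g([AX,AY],Z) + g([X,Y],A\<^sup>2Z) + g([AX,Y],AZ) + g([X,AY],AZ)\<close>. The covariant derivatives in these
  brackets cancel in pairs such as
  \<open>g(D\<^bsub>AX\<^esub>(AY), Z) + g(D\<^bsub>AX\<^esub> Y, AZ) = 0\<close>, and four torsion terms remain.
\<close>

lemma nijenhuis_wac_eq:
  assumes "vf X" "vf Y" "vf Z"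
  shows "nijenhuis_wac g Dg A \<eta> X Y Z p = T X Y (app11 Q Z) p
    - (T (app11 A X) (app11 A Y) Z p + T (app11 A X) Y (app11 A Z) p
       + T X (app11 A Y) (app11 A Z) p)"
proof -
  have AA: "T X Y (app11 A (app11 A Z)) p = - T X Y (app11 Q Z) p + app01 \<eta> Z p * T X Y \<xi> p"
    using metric_A[of "torsion D X Y" "app11 A Z"] metric_Q[of "torsion D X Y" Z]
      Q_symmetric[of "torsion D X Y" Z] assms
    by (simp add: torsion3_def \<eta>_eq[of "torsion D X Y"] vf_intros)
  show ?thesis
    using AA assms
    by (simp add: nijenhuis_wac_def nijenhuis_def metric_add metric_diff vf_intros
        metric_A metric_lie_bracket ext_deriv_\<eta> parallel_A)
qed

text \<open>
  By the symmetry of \<open>Q\<close> the right-hand side says \<open>T(X,QY) = Q T(X,Y)\<close>. The other relation follows from the skew-symmetry of the torsion in its first two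
  arguments: \<open>T(QX,Y) = - T(Y,QX) = - Q T(Y,X) = Q T(X,Y)\<close>.
\<close>

lemma Q_torsion_iff:
  "Q_torsion_condition M Q D \<longleftrightarrow>
    (\<forall>X Y Z. vf X \<longrightarrow> vf Y \<longrightarrow> vf Z \<longrightarrow> T X (app11 Q Y) Z = T X Y (app11 Q Z))"
  (is "_ \<longleftrightarrow> ?R")
proof
  assume "Q_torsion_condition M Q D"
  then show ?R
    by (simp add: Q_torsion_condition_def torsion3_def Q_symmetric vf_intros)
next
  assume R: ?R
  have right: "torsion D X (app11 Q Y) = app11 Q (torsion D X Y)" if "vf X" "vf Y" for X Y
    using R that
    by (intro metric_nondegenerate) (auto simp: torsion3_def Q_symmetric vf_intros)
  have left: "torsion D (app11 Q X) Y = torsion D X (app11 Q Y)" if vf: "vf X" "vf Y" for X Y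
  proof (rule metric_nondegenerate)
    fix Z assume Z: "vf Z"
    have "T (app11 Q X) Y Z p = T X (app11 Q Y) Z p" for p
      using T_skew(1)[of "app11 Q X" Y Z p] T_skew(1)[of X Y "app11 Q Z" p] R vf Z
      by (simp add: vf_Q)
    then show "app02 g (torsion D (app11 Q X) Y) Z = app02 g (torsion D X (app11 Q Y)) Z"
      by (simp add: torsion3_def fun_eq_iff)
  qed (simp_all add: vf vf_intros)
  show "Q_torsion_condition M Q D"
    using left right by (simp add: Q_torsion_condition_def)
qed

text \<open>
  Exchanging two arguments permutes the three terms that contain \<open>A\<close>, up to sign, so the only
  obstruction to total skew-symmetry of \<open>N\<close> is
  \<open>T(X,Z,QY) = - T(X,Y,QZ)\<close>, whose left-hand side is \<open>- T(X,QY,Z)\<close>.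
\<close>

lemma nijenhuis_skew_iff:
  "totally_skew M (nijenhuis_wac g Dg A \<eta>) \<longleftrightarrow>
    (\<forall>X Y Z. vf X \<longrightarrow> vf Y \<longrightarrow> vf Z \<longrightarrow> T X (app11 Q Y) Z = T X Y (app11 Q Z))"
proof -
  let ?N = "nijenhuis_wac g Dg A \<eta>"
  have "?N Y X Z = - ?N X Y Z \<and> (?N X Z Y = - ?N X Y Z \<longleftrightarrow> T X (app11 Q Y) Z = T X Y (app11 Q Z))"
    if vf: "vf X" "vf Y" "vf Z" for X Y Z
  proof
    let ?A = "app11 A" and ?Q = "app11 Q"
    show "?N Y X Z = - ?N X Y Z"
    proof
      fix p
      show "?N Y X Z p = (- ?N X Y Z) p"
        using T_skew(1)[of X Y "?Q Z" p] T_skew(1)[of "?A X" "?A Y" Z p]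
          T_skew(1)[of "?A X" Y "?A Z" p] T_skew(1)[of X "?A Y" "?A Z" p] vf
        by (simp add: nijenhuis_wac_eq vf_intros)
    qed
    have "?N X Z Y p = - ?N X Y Z p \<longleftrightarrow> T X (?Q Y) Z p = T X Y (?Q Z) p" for p
      using T_skew(2)[of X "?Q Y" Z p] T_skew(2)[of "?A X" "?A Y" Z p]
        T_skew(2)[of "?A X" Y "?A Z" p] T_skew(2)[of X "?A Y" "?A Z" p] vf
      by (simp add: nijenhuis_wac_eq vf_intros)
    then show "?N X Z Y = - ?N X Y Z \<longleftrightarrow> T X (?Q Y) Z = T X Y (?Q Z)"
      by (simp add: fun_eq_iff)
  qed
  then show ?thesis
    unfolding totally_skew_def by blast
qed

end

theorem theorem3p10:
  fixes M :: "('a::{t2_space, second_countable_topology}, 'e::euclidean_space) chart set"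
    and m :: nat
    and A Q :: "'a tensor11" and \<eta> :: "'a tensor01" and \<xi> :: "'a vfield" and g :: "'a tensor02"
    and D Dg :: "'a connection"
  assumes "weak_almost_contact_metric M m A Q \<eta> \<xi> g"
    and "levi_civita M g Dg"
    and "generalized_metric_connection M g (fundamental_form g A) D"
    and "totally_skew M (torsion3 g D)"
  shows "geodesic_field Dg \<xi> \<and> killing_field M g Dg \<xi> \<and>
    (Q_torsion_condition M Q D \<longleftrightarrow> totally_skew M (nijenhuis_wac g Dg A \<eta>))"
proof -
  interpret weak_acm_skew_torsion M m A Q \<eta> \<xi> g D Dg
    using assms by unfold_locales
  show ?thesis
    using geodesic_\<xi> killing_\<xi> Q_torsion_iff nijenhuis_skew_iff by simp
qed

end
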